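(* Let $H$ be a complex Hilbert space with open unit ball $\mathbb{B}$, and let $f:\mathbb{B}\to H$ be a holomorphic mapping which is the generator of a one-parameter continuous semigroup on $\mathbb{B}$. If for some $\tau\in\partial\mathbb{B}$ the $K$-limit $$K\text{-}\lim_{x\to\tau}\frac{f(x)}{\|x-\tau\|^{3}}=0,$$ then $f\equiv 0$ on $\mathbb{B}$.
   Context: $H$ is a complex Hilbert space (finite or infinite dimensional) with inner product $\langle\cdot,\cdot\rangle$ (linear in the first argument) and induced norm $\|\cdot\|$; $\mathbb{B}=\{x\in H:\|x\|<1\}$ and $\partial\mathbb{B}=\{x\in H:\|x\|=1\}$. Semigroup: a family $S=\{F_t\}_{t\ge 0}$ of holomorphic self-mappings of $\mathbb{B}$ is a one-parameter continuous semigroup on $\mathbb{B}$ if (i) $F_t(F_s(z))=F_{t+s}(z)$ for all $t,s\ge 0$ and all $z\in\mathbb{B}$, and (ii) $\lim_{t\to 0^+}F_t(z)=z$ (in norm) for all $z\in\mathbb{B}$. Generator: $f:\mathbb{B}\to H$ is the (infinitesimal) generator of $S$ if for each $z\in\mathbb{B}$ the strong (norm) limit $\lim_{t\to 0^+}\frac{1}{t}[z-F_t(z)]$ exists and equals $f(z)$ (note the sign convention). $K$-limit: for $\alpha>1$ and $\tau\in\partial\mathbb{B}$, the Koranyi approach region is $$D_\alpha(\tau)=\left\{x\in\mathbb{B}: |1-\langle x,\tau\rangle|<\tfrac{\alpha}{2}(1-\|x\|^2)\right\}.$$ A mapping $\varphi:\mathbb{B}\to H$ has $K$-limit $M$ at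 $\tau$, written $K\text{-}\lim_{x\to\tau}\varphi(x)=M$, if $\varphi$ tends to $M$ along every curve ending at $\tau$ and lying in a Koranyi region $D_\alpha(\tau)$, $\alpha>1$. *)

theory Defs
  imports "HOL-Analysis.Analysis"
begin

text \<open>The distribution has no type class of complex inner product spaces. The real structure
  (real scaling, norm, topology) is the underlying one: \<open>inner\<close> is the real part of \<open>cinner\<close>, so
  the norm of \<^class>\<open>real_inner\<close> is the one induced by \<open>cinner\<close> (lemma \<open>norm_eq_sqrt_cinner\<close>).
  As usual in complex analysis on the ball, \<open>cinner\<close> is linear in its first argument.\<close>

class complex_hilbert_space = real_inner + complete_space +
  fixes scaleC :: "complex \<Rightarrow> 'a \<Rightarrow> 'a"  (infixr "*\<^sub>C" 75)
    and cinner :: "'a \<Rightarrow> 'a \<Rightarrow> complex"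
  assumes scaleC_add_right: "a *\<^sub>C (x + y) = a *\<^sub>C x + a *\<^sub>C y"
    and scaleC_add_left: "(a + b) *\<^sub>C x = a *\<^sub>C x + b *\<^sub>C x"
    and scaleC_scaleC: "a *\<^sub>C (b *\<^sub>C x) = (a * b) *\<^sub>C x"
    and scaleC_of_real: "complex_of_real r *\<^sub>C x = r *\<^sub>R x"
    and cinner_add_left: "cinner (x + y) z = cinner x z + cinner y z"
    and cinner_scaleC_left: "cinner (a *\<^sub>C x) y = a * cinner x y"
    and cinner_commute: "cinner x y = cnj (cinner y x)"
    and inner_eq_Re_cinner: "inner x y = Re (cinner x y)"

lemma cinner_self: "cinner x x = complex_of_real ((norm x)\<^sup>2)"
  for x :: "'a::complex_hilbert_space"
proof (rule complex_eqI)
  show "Re (cinner x x) = Re (complex_of_real ((norm x)\<^sup>2))"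
    by (simp add: inner_eq_Re_cinner[symmetric] power2_norm_eq_inner)
  have "Im (cinner x x) = - Im (cinner x x)"
    by (subst cinner_commute) simp
  then show "Im (cinner x x) = Im (complex_of_real ((norm x)\<^sup>2))"
    by simp
qed

lemma norm_eq_sqrt_cinner: "norm x = sqrt (Re (cinner x x))"
  for x :: "'a::complex_hilbert_space"
  by (simp add: cinner_self)

definition holomorphic_map_on ::
    "('a::complex_hilbert_space \<Rightarrow> 'b::complex_hilbert_space) \<Rightarrow> 'a set \<Rightarrow> bool" where
  "holomorphic_map_on f U \<longleftrightarrow>
     (\<forall>z\<in>U. \<exists>f'. (f has_derivative f') (at z within U) \<and> (\<forall>a v. f' (a *\<^sub>C v) = a *\<^sub>C f' v))"

definition continuous_semigroup :: "(real \<Rightarrow> 'a::complex_hilbert_space \<Rightarrow> 'a) \<Rightarrow> bool" where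
  "continuous_semigroup F \<longleftrightarrow>
     (\<forall>t\<ge>0. holomorphic_map_on (F t) (ball 0 1) \<and> F t ` ball 0 1 \<subseteq> ball 0 1) \<and>
     (\<forall>t\<ge>0. \<forall>s\<ge>0. \<forall>z\<in>ball 0 1. F t (F s z) = F (t + s) z) \<and>
     (\<forall>z\<in>ball 0 1. ((\<lambda>t. F t z) \<longlongrightarrow> z) (at_right 0))"

definition is_generator ::
    "('a::complex_hilbert_space \<Rightarrow> 'a) \<Rightarrow> (real \<Rightarrow> 'a \<Rightarrow> 'a) \<Rightarrow> bool" where
  "is_generator f F \<longleftrightarrow>
     (\<forall>z\<in>ball 0 1. ((\<lambda>t. (1 / t) *\<^sub>R (z - F t z)) \<longlongrightarrow> f z) (at_right 0))"

definition koranyi_region :: "real \<Rightarrow> 'a::complex_hilbert_space \<Rightarrow> 'a set" where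
  "koranyi_region \<alpha> \<tau> =
     {x \<in> ball 0 1. cmod (1 - cinner x \<tau>) < \<alpha> / 2 * (1 - (norm x)\<^sup>2)}"

text \<open>A curve ending at \<open>\<tau>\<close> is a continuous map on \<open>[0, 1)\<close> tending to \<open>\<tau>\<close> at \<open>1\<close>.\<close>

definition has_K_limit ::
    "('a::complex_hilbert_space \<Rightarrow> 'b::topological_space) \<Rightarrow> 'b \<Rightarrow> 'a \<Rightarrow> bool" where
  "has_K_limit \<phi> M \<tau> \<longleftrightarrow>
     (\<forall>\<alpha>>1. \<forall>\<gamma> :: real \<Rightarrow> 'a.
        continuous_on {0..<1} \<gamma> \<and> \<gamma> ` {0..<1} \<subseteq> koranyi_region \<alpha> \<tau> \<and>
        (\<gamma> \<longlongrightarrow> \<tau>) (at_left 1) \<longrightarrow>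
        ((\<lambda>s. \<phi> (\<gamma> s)) \<longlongrightarrow> M) (at_left 1))"

end

theory Submission
  imports Defs "HOL-Complex_Analysis.Complex_Analysis"
begin

text \<open>Every point \<open>z\<close> of the ball lies on an affine disc \<open>\<zeta> \<mapsto> a + \<zeta> b\<close> with \<open>a \<bottom> b\<close> and
  \<open>a + b = \<tau>\<close>. The map \<open>x \<mapsto> \<langle>x, b\<rangle> / (1 - \<langle>x, a\<rangle>)\<close> sends the ball to the unit disc and is a left
  inverse of it. Conjugating the semigroup with these two maps shows that
  \<open>h \<zeta> = (\<langle>f, b\<rangle> + \<zeta> \<langle>f, a\<rangle>) / \<parallel>b\<parallel>\<^sup>2\<close>, with \<open>f\<close> taken at \<open>a + \<zeta> b\<close>, is the derivative at time 0 of a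
  family of self-maps of the disc, and \<open>h r = o((1 - r)\<^sup>3)\<close>.

  Differentiating the Schwarz--Pick inequality at time 0 and moving one of its points to 1 gives
  \<open>Re p \<ge> 0\<close> for \<open>p \<zeta> = - h \<zeta> / (1 - \<zeta>)\<^sup>2\<close>. As \<open>p r = o(1 - r)\<close>, Harnack's inequality forces \<open>p = 0\<close>.

  Hence \<open>\<langle>f z, \<tau>\<rangle> (1 - \<langle>z, z\<rangle>) = \<langle>f z, z\<rangle> (1 - \<langle>z, \<tau>\<rangle>)\<close> on the ball. The antilinear part of the derivative
  of this identity says \<open>\<langle>f z, \<tau>\<rangle> \<langle>z, v\<rangle> + \<langle>f z, v\<rangle> (1 - \<langle>z, \<tau>\<rangle>) = 0\<close> for all \<open>v\<close>; with \<open>v = z\<close> it yields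
  \<open>\<langle>f z, \<tau>\<rangle> = 0\<close>, and then \<open>v = f z\<close> yields \<open>f z = 0\<close>.\<close>

section \<open>Generators on the unit disc\<close>

text \<open>Divided by \<open>(cmod (1 - cnj w * z))\<^sup>2\<close>, the left side is one minus the
  squared pseudo-hyperbolic distance of \<open>z\<close> and \<open>w\<close>. This removes the
  differences from the Schwarz-Pick inequality.\<close>

lemma moebius_identity:
  "(cmod (1 - cnj w * z))\<^sup>2 - (cmod (z - w))\<^sup>2 = (1 - (cmod z)\<^sup>2) * (1 - (cmod w)\<^sup>2)"
  unfolding cmod_power2 by (simp add: algebra_simps power2_eq_square)

lemma one_minus_cnj_mult_nonzero:
  assumes "cmod z < 1" "cmod w < 1"
  shows "1 - cnj w * z \<noteq> 0"
proof
  assume "1 - cnj w * z = 0"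
  then have "cmod (cnj w * z) = 1" by (metis eq_iff_diff_eq_0 norm_one)
  moreover have "cmod (cnj w * z) < 1"
    using assms mult_strict_mono'[of "cmod w" 1 "cmod z" 1] by (simp add: norm_mult)
  ultimately show False by simp
qed

text \<open>The Schwarz lemma applies to \<open>g\<close>, which is \<open>G\<close> composed with
  disc automorphisms so that 0 is fixed. The form without quotients can be expanded in time when
  \<open>G\<close> is close to the identity.\<close>

lemma Schwarz_Pick:
  assumes hol: "G holomorphic_on ball 0 1" and bd: "\<And>x. cmod x < 1 \<Longrightarrow> cmod (G x) < 1"
    and z: "cmod z < 1" and w: "cmod w < 1"
  shows "(1 - (cmod z)\<^sup>2) * (1 - (cmod w)\<^sup>2) * (cmod (1 - cnj (G w) * G z))\<^sup>2
    \<le> (1 - (cmod (G z))\<^sup>2) * (1 - (cmod (G w))\<^sup>2) * (cmod (1 - cnj w * z))\<^sup>2"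
proof -
  let ?M = "Moebius_function 0"
  define g where "g = ?M (G w) \<circ> (G \<circ> ?M (- w))"
  have M: "cmod (?M u x) < 1" if "cmod u < 1" "cmod x < 1" for u x
    using that by (simp add: Moebius_function_norm_lt_1)
  have "g holomorphic_on ball 0 1"
    unfolding g_def
    by (intro holomorphic_on_compose_gen[where t = "ball 0 1"] Moebius_function_holomorphic)
      (use hol bd w M in auto)
  moreover have "g 0 = 0"
    by (simp add: g_def Moebius_function_simple)
  moreover have "cmod (g x) < 1" if "cmod x < 1" for x
    using that bd w M by (simp add: g_def)
  ultimately have "cmod (g (?M w z)) \<le> cmod (?M w z)"
    using Schwarz_Lemma(1)[of g "?M w z"] M[OF w z] by blast
  moreover have "?M (- w) (?M w z) = z"
    using Moebius_function_compose[of "- w" w z] w z by simp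
  ultimately have "cmod (G z - G w) / cmod (1 - cnj (G w) * G z) \<le> cmod (z - w) / cmod (1 - cnj w * z)"
    by (simp add: g_def Moebius_function_simple norm_divide)
  moreover have "0 < cmod (1 - cnj (G w) * G z)" "0 < cmod (1 - cnj w * z)"
    using one_minus_cnj_mult_nonzero bd z w by auto
  ultimately have "cmod (G z - G w) * cmod (1 - cnj w * z) \<le> cmod (z - w) * cmod (1 - cnj (G w) * G z)"
    by (simp add: field_simps)
  then have "(cmod (G z - G w) * cmod (1 - cnj w * z))\<^sup>2 \<le> (cmod (z - w) * cmod (1 - cnj (G w) * G z))\<^sup>2"
    by (intro power_mono) auto
  then show ?thesis
    unfolding moebius_identity[symmetric] by (simp add: algebra_simps power_mult_distrib)
qed

text \<open>This is the 2 by 2 determinant condition for the positive kernel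
  \<open>(p z + cnj (p w)) / (1 - cnj w * z)\<close>. Strict positivity keeps the Cayley transform
  of \<open>p\<close> inside the open disc.\<close>

lemma Harnack_two_point_pos:
  assumes hol: "p holomorphic_on ball 0 1" and pos: "\<And>x. cmod x < 1 \<Longrightarrow> 0 < Re (p x)"
    and z: "cmod z < 1" and w: "cmod w < 1"
  shows "(1 - (cmod z)\<^sup>2) * (1 - (cmod w)\<^sup>2) * (cmod (p z + cnj (p w)))\<^sup>2
    \<le> 4 * Re (p z) * Re (p w) * (cmod (1 - cnj w * z))\<^sup>2"
proof -
  \<comment> \<open>The Cayley transform turns the claim into Schwarz--Pick.\<close>
  define G where "G x = (p x - 1) / (p x + 1)" for x
  have nz: "p x + 1 \<noteq> 0" if "cmod x < 1" for x
    using pos[OF that] by (auto simp: complex_eq_iff)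
  have G2: "1 - (cmod (G x))\<^sup>2 = 4 * Re (p x) / (cmod (p x + 1))\<^sup>2" if "cmod x < 1" for x
  proof -
    have "(cmod (p x + 1))\<^sup>2 - (cmod (p x - 1))\<^sup>2 = 4 * Re (p x)"
      unfolding cmod_power2 by (simp add: algebra_simps power2_eq_square)
    moreover have "1 - (cmod (G x))\<^sup>2 = ((cmod (p x + 1))\<^sup>2 - (cmod (p x - 1))\<^sup>2) / (cmod (p x + 1))\<^sup>2"
      using nz[OF that] unfolding G_def norm_divide power_divide by (simp add: diff_divide_distrib)
    ultimately show ?thesis by simp
  qed
  have bd: "cmod (G x) < 1" if "cmod x < 1" for x
  proof -
    have "0 < 1 - (cmod (G x))\<^sup>2"
      unfolding G2[OF that] using pos[OF that] nz[OF that] by simp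
    then show ?thesis
      by (simp add: abs_square_less_1)
  qed
  have "1 - cnj (G w) * G z = 2 * (p z + cnj (p w)) / ((p z + 1) * cnj (p w + 1))"
  proof -
    have "(p z + 1) * cnj (p w + 1) \<noteq> 0"
      using nz[OF z] nz[OF w] by (metis complex_cnj_zero_iff mult_eq_0_iff)
    moreover have "cnj (G w) * G z = (p z - 1) * cnj (p w - 1) / ((p z + 1) * cnj (p w + 1))"
      by (simp add: G_def mult.commute)
    ultimately have "1 - cnj (G w) * G z
        = ((p z + 1) * cnj (p w + 1) - (p z - 1) * cnj (p w - 1)) / ((p z + 1) * cnj (p w + 1))"
      unfolding diff_divide_distrib by simp
    also have "(p z + 1) * cnj (p w + 1) - (p z - 1) * cnj (p w - 1) = 2 * (p z + cnj (p w))"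
      by (simp add: algebra_simps)
    finally show ?thesis .
  qed
  then have Gzw: "(cmod (1 - cnj (G w) * G z))\<^sup>2
      = 4 * (cmod (p z + cnj (p w)))\<^sup>2 / ((cmod (p z + 1))\<^sup>2 * (cmod (p w + 1))\<^sup>2)"
    by (simp add: norm_divide norm_mult power_divide power_mult_distrib
        del: complex_cnj_add distrib_left_numeral)
  have "G holomorphic_on ball 0 1"
    unfolding G_def by (intro holomorphic_intros hol) (use nz in auto)
  note SP = Schwarz_Pick[OF this bd z w, unfolded G2[OF z] G2[OF w] Gzw]
  let ?P = "(cmod (p z + 1))\<^sup>2" and ?Q = "(cmod (p w + 1))\<^sup>2"
  have scale: "X * (4 * C / (P * Q)) = 4 / (P * Q) * (X * C)"
      "4 * a / P * (4 * b / Q) * D = 4 / (P * Q) * (4 * a * b * D)" for X C P Q a b D :: real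
    by simp_all
  have "0 < 4 / (?P * ?Q)" using nz[OF z] nz[OF w] by simp
  then show ?thesis
    using SP unfolding scale by (simp only: mult_le_cancel_left_pos)
qed

text \<open>Adding \<open>\<epsilon> > 0\<close> to \<open>p\<close> gives the strict case, and both
  sides are continuous in \<open>\<epsilon>\<close>.\<close>

lemma Harnack_two_point:
  assumes hol: "p holomorphic_on ball 0 1" and pos: "\<And>x. cmod x < 1 \<Longrightarrow> 0 \<le> Re (p x)"
    and z: "cmod z < 1" and w: "cmod w < 1"
  shows "(1 - (cmod z)\<^sup>2) * (1 - (cmod w)\<^sup>2) * (cmod (p z + cnj (p w)))\<^sup>2
    \<le> 4 * Re (p z) * Re (p w) * (cmod (1 - cnj w * z))\<^sup>2" (is "?L \<le> ?R")
proof -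
  let ?q = "\<lambda>\<epsilon> x. p x + complex_of_real \<epsilon>"
  let ?l = "\<lambda>\<epsilon>. (1 - (cmod z)\<^sup>2) * (1 - (cmod w)\<^sup>2) * (cmod (?q \<epsilon> z + cnj (?q \<epsilon> w)))\<^sup>2"
  let ?r = "\<lambda>\<epsilon>. 4 * Re (?q \<epsilon> z) * Re (?q \<epsilon> w) * (cmod (1 - cnj w * z))\<^sup>2"
  have "(?l \<longlongrightarrow> ?l 0) (at_right 0)" "(?r \<longlongrightarrow> ?r 0) (at_right 0)"
    by (intro tendsto_intros)+
  moreover have "eventually (\<lambda>\<epsilon>. ?l \<epsilon> \<le> ?r \<epsilon>) (at_right 0)"
    using eventually_at_right_less[of 0]
  proof eventually_elim
    case (elim \<epsilon>)
    show ?case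
      by (rule Harnack_two_point_pos[OF _ _ z w])
        (use hol pos elim in \<open>auto intro!: holomorphic_intros add_nonneg_pos\<close>)
  qed
  ultimately have "?l 0 \<le> ?r 0"
    by (intro tendsto_le[of "at_right 0"]) auto
  then show ?thesis by simp
qed

section \<open>Differentiation at time 0 and flatness at a boundary point\<close>

text \<open>As \<open>t\<close> tends to 0, \<open>G t\<close> tends to the identity, for which
  Schwarz-Pick is an equality; hence the first-order terms in \<open>t\<close> satisfy the
  inequality. The statement speaks of a family of self-maps because retracting a semigroup to a disc
  need not give a semigroup.\<close>

lemma disc_generator_two_point:
  fixes G :: "real \<Rightarrow> complex \<Rightarrow> complex"
  assumes hol: "\<And>t. 0 < t \<Longrightarrow> G t holomorphic_on ball 0 1"
    and bd: "\<And>t x. 0 < t \<Longrightarrow> cmod x < 1 \<Longrightarrow> cmod (G t x) < 1"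
    and lim: "\<And>x. cmod x < 1 \<Longrightarrow> ((\<lambda>t. (x - G t x) / of_real t) \<longlongrightarrow> h x) (at_right 0)"
    and z: "cmod z < 1" and w: "cmod w < 1"
  shows "(1 - (cmod z)\<^sup>2) * (1 - (cmod w)\<^sup>2) * Re ((h z * cnj w + z * cnj (h w)) * cnj (1 - cnj w * z))
    \<le> (Re (h z * cnj z) * (1 - (cmod w)\<^sup>2) + Re (h w * cnj w) * (1 - (cmod z)\<^sup>2)) * (cmod (1 - cnj w * z))\<^sup>2"
proof -
  define Q where "Q x t = (x - G t x) / of_real t" for x t
  have Glim: "((\<lambda>t. G t x) \<longlongrightarrow> x) (at_right 0)" if "cmod x < 1" for x
  proof -
    have "((\<lambda>t. x - of_real t * Q x t) \<longlongrightarrow> x - of_real 0 * h x) (at_right 0)"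
      using lim[OF that] unfolding Q_def by (intro tendsto_intros)
    moreover have "eventually (\<lambda>t. x - of_real t * Q x t = G t x) (at_right 0)"
      using eventually_at_right_less[of 0] by eventually_elim (simp add: Q_def)
    ultimately show ?thesis by (simp add: tendsto_cong)
  qed
  \<comment> \<open>For \<open>t > 0\<close>, \<open>t * A x t\<close> is exactly
    \<open>(cmod x)\<^sup>2 - (cmod (G t x))\<^sup>2\<close>, factored as a difference of
    squares.\<close>
  define A where "A x t = Re (Q x t * cnj x) + Re (Q x t * cnj (G t x))" for x t
  have A_lim: "(A x \<longlongrightarrow> 2 * Re (h x * cnj x)) (at_right 0)" if "cmod x < 1" for x
  proof -
    have "(A x \<longlongrightarrow> Re (h x * cnj x) + Re (h x * cnj x)) (at_right 0)"
      unfolding A_def Q_def by (intro tendsto_intros lim Glim that)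
    then show ?thesis unfolding mult_2 .
  qed
  have A_eq: "1 - (cmod (G t x))\<^sup>2 = 1 - (cmod x)\<^sup>2 + t * A x t" if "0 < t" for x t
  proof -
    have "t * A x t = Re ((x - G t x) * cnj x) + Re ((x - G t x) * cnj (G t x))"
      using that by (simp add: A_def Q_def field_simps)
    then show ?thesis
      unfolding cmod_power2 by (simp add: algebra_simps power2_eq_square)
  qed
  \<comment> \<open>\<open>V\<close> is the difference quotient of
    \<open>1 - cnj (G t w) * G t z\<close>, split as in the product rule.\<close>
  define V where "V t = cnj w * Q z t + cnj (Q w t) * G t z" for t
  have V_lim: "(V \<longlongrightarrow> cnj w * h z + cnj (h w) * z) (at_right 0)"
    unfolding V_def Q_def by (intro tendsto_intros lim Glim z w)
  have V_eq: "1 - cnj (G t w) * G t z = 1 - cnj w * z + of_real t * V t" if "0 < t" for t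
    using that by (simp add: V_def Q_def field_simps)
  let ?c = "1 - cnj w * z"
  have C_eq: "(cmod (1 - cnj (G t w) * G t z))\<^sup>2 = (cmod ?c)\<^sup>2 + t * (2 * Re (V t * cnj ?c) + t * (cmod (V t))\<^sup>2)"
    if "0 < t" for t
    unfolding V_eq[OF that] cmod_power2 by (simp add: algebra_simps power2_eq_square)
  let ?a = "1 - (cmod z)\<^sup>2" and ?b = "1 - (cmod w)\<^sup>2"
  let ?l = "\<lambda>t. ?a * ?b * (2 * Re (V t * cnj ?c) + t * (cmod (V t))\<^sup>2)"
  let ?r = "\<lambda>t. (A z t * ?b + A w t * ?a + t * A z t * A w t) * (cmod ?c)\<^sup>2"
  have "?l t \<le> ?r t" if "0 < t" for t
  proof -
    \<comment> \<open>The zero-order term \<open>?a * ?b * (cmod ?c)\<^sup>2\<close> is common to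
      both sides, so what remains can be divided by \<open>t\<close>.\<close>
    have "?a * ?b * ((cmod ?c)\<^sup>2 + t * (2 * Re (V t * cnj ?c) + t * (cmod (V t))\<^sup>2))
        \<le> (?a + t * A z t) * (?b + t * A w t) * (cmod ?c)\<^sup>2"
      using Schwarz_Pick[OF hol bd z w, of t] that
      unfolding A_eq[OF that] C_eq[OF that] by blast
    then have "t * ?l t \<le> t * ?r t" by (simp add: algebra_simps)
    then show ?thesis using that by simp
  qed
  then have "eventually (\<lambda>t. ?l t \<le> ?r t) (at_right 0)"
    using eventually_at_right_less[of 0] by (auto elim: eventually_mono)
  \<comment> \<open>In both limits the terms with factor 0 come from the terms of higher order in
    \<open>t\<close>.\<close>
  moreover have "(?l \<longlongrightarrow> ?a * ?b * (2 * Re ((cnj w * h z + cnj (h w) * z) * cnj ?c)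
      + 0 * (cmod (cnj w * h z + cnj (h w) * z))\<^sup>2)) (at_right 0)"
    by (intro tendsto_intros V_lim)
  moreover have "(?r \<longlongrightarrow> (2 * Re (h z * cnj z) * ?b + 2 * Re (h w * cnj w) * ?a
      + 0 * (2 * Re (h z * cnj z)) * (2 * Re (h w * cnj w))) * (cmod ?c)\<^sup>2) (at_right 0)"
    by (intro tendsto_intros A_lim z w)
  ultimately have "?a * ?b * (2 * Re ((cnj w * h z + cnj (h w) * z) * cnj ?c)
      + 0 * (cmod (cnj w * h z + cnj (h w) * z))\<^sup>2) \<le> (2 * Re (h z * cnj z) * ?b + 2 * Re (h w * cnj w) * ?a
      + 0 * (2 * Re (h z * cnj z)) * (2 * Re (h w * cnj w))) * (cmod ?c)\<^sup>2"
    by (intro tendsto_le[of "at_right 0"]) auto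
  then have "2 * (?a * ?b * Re ((h z * cnj w + z * cnj (h w)) * cnj ?c))
      \<le> 2 * ((Re (h z * cnj z) * ?b + Re (h w * cnj w) * ?a) * (cmod ?c)\<^sup>2)"
    by (simp add: algebra_simps)
  then show ?thesis by linarith
qed

text \<open>Writing \<open>h x = - (1 - x)\<^sup>2 * p x\<close> with
  \<open>0 \<le> Re (p x)\<close> is the Berkson-Porta form for the boundary point 1; the sign
  reflects that \<open>h\<close> is minus the velocity. Such a \<open>p\<close>, unless zero, cannot
  be \<open>o(1 - r)\<close> along the radius.\<close>

lemma disc_generator_eq_0:
  fixes G :: "real \<Rightarrow> complex \<Rightarrow> complex"
  assumes hol: "\<And>t. 0 < t \<Longrightarrow> G t holomorphic_on ball 0 1"
    and bd: "\<And>t x. 0 < t \<Longrightarrow> cmod x < 1 \<Longrightarrow> cmod (G t x) < 1"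
    and lim: "\<And>x. cmod x < 1 \<Longrightarrow> ((\<lambda>t. (x - G t x) / of_real t) \<longlongrightarrow> h x) (at_right 0)"
    and h_hol: "h holomorphic_on ball 0 1"
    and flat: "((\<lambda>r. h (of_real r) / of_real ((1 - r) ^ 3)) \<longlongrightarrow> 0) (at_left 1)"
    and z: "cmod z < 1"
  shows "h z = 0"
proof -
  define p where "p x = - h x / (1 - x)\<^sup>2" for x
  define q where "q r = h (of_real r) / of_real ((1 - r) ^ 3)" for r :: real
  have q: "(q \<longlongrightarrow> 0) (at_left 1)"
    using flat unfolding q_def .
  have near: "eventually (\<lambda>r::real. 0 < r \<and> r < 1) (at_left 1)"
    using eventually_at_left_real[of 0 "1::real"] by (auto elim: eventually_mono)
  have h_q: "h (of_real r) = of_real ((1 - r) ^ 3) * q r" if "r < 1" for r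
    using that by (simp add: q_def)
  have ne1: "1 - x \<noteq> 0" if "cmod x < 1" for x
    using that by auto
  have p_pos: "0 \<le> Re (p x)" if x: "cmod x < 1" for x
  proof -
    let ?a = "1 - (cmod x)\<^sup>2"
    let ?l = "\<lambda>r::real. ?a * (1 + r) * Re ((h x * of_real r + x * cnj (of_real ((1 - r) ^ 3) * q r)) * cnj (1 - of_real r * x))"
    let ?r = "\<lambda>r::real. (Re (h x * cnj x) * (1 + r) + Re (of_real ((1 - r)\<^sup>2) * q r * of_real r) * ?a) * (cmod (1 - of_real r * x))\<^sup>2"
    \<comment> \<open>In the two-point inequality with \<open>w = r\<close>, the factor
      \<open>1 - r\<close> cancels from every term, and the remaining multiples of
      \<open>q r\<close> vanish in the limit.\<close>
    have "eventually (\<lambda>r. ?l r \<le> ?r r) (at_left 1)"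
      using near
    proof eventually_elim
      case (elim r)
      then have r: "cmod (of_real r) < 1" by simp
      have eq: "1 - (cmod (of_real r))\<^sup>2 = (1 - r) * (1 + r)"
        by (simp add: power2_eq_square algebra_simps)
      have "?a * ((1 - r) * (1 + r)) * Re ((h x * of_real r + x * cnj (of_real ((1 - r) ^ 3) * q r)) * cnj (1 - of_real r * x))
        \<le> (Re (h x * cnj x) * ((1 - r) * (1 + r)) + Re (of_real ((1 - r) ^ 3) * q r * of_real r) * ?a) * (cmod (1 - of_real r * x))\<^sup>2"
        using disc_generator_two_point[OF hol bd lim x r] elim
        unfolding eq h_q[of r, OF conjunct2[OF elim]] complex_cnj_complex_of_real by blast
      then have "(1 - r) * ?l r \<le> (1 - r) * ?r r"
        by (simp add: algebra_simps power2_eq_square power3_eq_cube)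
      then show ?case using elim by simp
    qed
    moreover have "(?l \<longlongrightarrow> ?a * (1 + 1) * Re ((h x * of_real 1 + x * cnj (of_real ((1 - 1) ^ 3) * 0)) * cnj (1 - of_real 1 * x))) (at_left 1)"
      by (intro tendsto_intros q)
    moreover have "(?r \<longlongrightarrow> (Re (h x * cnj x) * (1 + 1) + Re (of_real ((1 - 1)\<^sup>2) * 0 * of_real 1) * ?a) * (cmod (1 - of_real 1 * x))\<^sup>2) (at_left 1)"
      by (intro tendsto_intros q)
    ultimately have "?a * (1 + 1) * Re ((h x * of_real 1 + x * cnj (of_real ((1 - 1) ^ 3) * 0)) * cnj (1 - of_real 1 * x))
       \<le> (Re (h x * cnj x) * (1 + 1) + Re (of_real ((1 - 1)\<^sup>2) * 0 * of_real 1) * ?a) * (cmod (1 - of_real 1 * x))\<^sup>2"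
      by (intro tendsto_le[of "at_left (1::real)"]) auto
    then have "?a * Re (h x * cnj (1 - x)) \<le> Re (h x * cnj x) * (cmod (1 - x))\<^sup>2"
      by (simp add: algebra_simps)
    \<comment> \<open>Factor out \<open>h x * cnj (1 - x)\<close> and use
      \<open>cnj x * (1 - x) - (1 - (cmod x)\<^sup>2) = - cnj (1 - x)\<close>.\<close>
    moreover have "Re (h x * cnj x) * (cmod (1 - x))\<^sup>2 - ?a * Re (h x * cnj (1 - x)) = Re (- h x * (cnj (1 - x))\<^sup>2)"
      unfolding cmod_power2 by (simp add: algebra_simps power2_eq_square)
    ultimately have "0 \<le> Re (- h x * (cnj (1 - x))\<^sup>2)"
      by linarith
    moreover have "p x = - h x * (cnj (1 - x))\<^sup>2 / of_real ((cmod (1 - x))\<^sup>2 * (cmod (1 - x))\<^sup>2)"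
    proof -
      have "of_real ((cmod (1 - x))\<^sup>2 * (cmod (1 - x))\<^sup>2) = (1 - x)\<^sup>2 * (cnj (1 - x))\<^sup>2"
        unfolding of_real_mult complex_norm_square by (simp add: power2_eq_square)
      moreover have "cnj (1 - x) \<noteq> 0"
        using ne1[OF x] by (metis complex_cnj_zero_iff)
      ultimately show ?thesis
        by (simp add: p_def)
    qed
    ultimately show ?thesis
      by (simp only: Re_divide_of_real) (intro divide_nonneg_nonneg mult_nonneg_nonneg zero_le_power2)
  qed
  have p_hol: "p holomorphic_on ball 0 1"
    unfolding p_def by (intro holomorphic_intros h_hol) (use ne1 in auto)
  let ?a = "1 - (cmod z)\<^sup>2"
  let ?s = "\<lambda>r. - of_real (1 - r) * q r"
  let ?l = "\<lambda>r. ?a * (1 + r) * (cmod (p z + cnj (?s r)))\<^sup>2"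
  let ?r = "\<lambda>r. 4 * Re (p z) * Re (- q r) * (cmod (1 - of_real r * z))\<^sup>2"
  \<comment> \<open>The cubic rate gives \<open>p r = - (1 - r) * q r\<close>. After cancelling
    \<open>1 - r\<close> in Harnack's inequality, the right side still carries \<open>q r\<close>
    and tends to 0, while the left tends to a positive multiple of
    \<open>(cmod (p z))\<^sup>2\<close>.\<close>
  have "eventually (\<lambda>r. ?l r \<le> ?r r) (at_left 1)"
    using near
  proof eventually_elim
    case (elim r)
    then have r: "cmod (of_real r) < 1" by simp
    have eq: "1 - (cmod (of_real r))\<^sup>2 = (1 - r) * (1 + r)"
      by (simp add: power2_eq_square algebra_simps)
    have "p (of_real r) = ?s r"
    proof -
      have "- H / c\<^sup>2 = - c * (H / c ^ 3)" if "c \<noteq> 0" for H c :: complex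
        using that by (simp add: power2_eq_square power3_eq_cube)
      from this[OF ne1[OF r]] show ?thesis
        by (simp add: p_def q_def)
    qed
    then have "?a * ((1 - r) * (1 + r)) * (cmod (p z + cnj (?s r)))\<^sup>2
        \<le> 4 * Re (p z) * Re (?s r) * (cmod (1 - of_real r * z))\<^sup>2"
      using Harnack_two_point[OF p_hol p_pos z r] unfolding eq complex_cnj_complex_of_real by simp
    then have "(1 - r) * ?l r \<le> (1 - r) * ?r r"
      by (simp add: algebra_simps)
    moreover have "0 < 1 - r" using elim by simp
    ultimately show ?case by (simp only: mult_le_cancel_left_pos)
  qed
  moreover have "(?l \<longlongrightarrow> ?a * (1 + 1) * (cmod (p z + cnj (- of_real (1 - 1) * 0)))\<^sup>2) (at_left 1)"
    by (intro tendsto_intros q)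
  moreover have "(?r \<longlongrightarrow> 4 * Re (p z) * Re (- 0) * (cmod (1 - of_real 1 * z))\<^sup>2) (at_left 1)"
    by (intro tendsto_intros q)
  ultimately have "?a * (1 + 1) * (cmod (p z + cnj (- of_real (1 - 1) * 0)))\<^sup>2
      \<le> 4 * Re (p z) * Re (- 0) * (cmod (1 - of_real 1 * z))\<^sup>2"
    by (intro tendsto_le[of "at_left (1::real)"]) auto
  then have "?a * (cmod (p z))\<^sup>2 \<le> 0" by (simp add: algebra_simps)
  moreover have "0 < ?a" using z by (simp add: abs_square_less_1)
  ultimately have "p z = 0"
    by (simp add: mult_le_0_iff)
  then show ?thesis
    using ne1[OF z] by (simp add: p_def)
qed

section \<open>Complex inner products\<close>

lemma cinner_add_right: "cinner x (y + z) = cinner x y + cinner x z"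
  by (metis cinner_add_left cinner_commute complex_cnj_add)

lemma cinner_scaleC_right: "cinner x (a *\<^sub>C y) = cnj a * cinner x y"
  by (metis cinner_commute cinner_scaleC_left complex_cnj_mult)

lemma cinner_zero_left [simp]: "cinner 0 x = 0"
  using cinner_add_left[of 0 0 x] by simp

lemma cinner_zero_right [simp]: "cinner x 0 = 0"
  using cinner_add_right[of x 0 0] by simp

lemma cinner_minus_left: "cinner (- x) y = - cinner x y"
  using cinner_add_left[of x "- x" y] by (simp add: eq_neg_iff_add_eq_0 add.commute)

lemma cinner_diff_left: "cinner (x - y) z = cinner x z - cinner y z"
  using cinner_add_left[of x "- y" z] by (simp add: cinner_minus_left)

lemma cinner_diff_right: "cinner x (y - z) = cinner x y - cinner x z"
  by (metis cinner_diff_left cinner_commute complex_cnj_diff)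

lemma norm_scaleC: "norm (a *\<^sub>C x) = cmod a * norm x"
proof -
  have "complex_of_real ((norm (a *\<^sub>C x))\<^sup>2) = complex_of_real ((cmod a)\<^sup>2) * of_real ((norm x)\<^sup>2)"
    unfolding cinner_self[symmetric] complex_norm_square
    by (simp add: cinner_scaleC_left cinner_scaleC_right)
  then have "(norm (a *\<^sub>C x))\<^sup>2 = (cmod a * norm x)\<^sup>2"
    unfolding power_mult_distrib of_real_mult[symmetric] of_real_eq_iff .
  then show ?thesis by (simp add: power2_eq_iff_nonneg)
qed

text \<open>Multiplying \<open>x\<close> by the unimodular \<open>c\<close> (or by 0, if the product
  vanishes) makes the product real and nonnegative, so the real Cauchy-Schwarz inequality
  applies.\<close>

lemma norm_cinner_le: "cmod (cinner x y) \<le> norm x * norm y"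
proof -
  define c where "c = cnj (sgn (cinner x y))"
  have "cinner (c *\<^sub>C x) y = of_real (cmod (cinner x y))"
    by (cases "cinner x y = 0")
      (simp_all add: c_def cinner_scaleC_left sgn_eq mult.commute[of "cnj _"] power2_eq_square
        flip: complex_norm_square)
  then have "cmod (cinner x y) = inner (c *\<^sub>C x) y"
    by (simp add: inner_eq_Re_cinner)
  also have "\<dots> \<le> norm (c *\<^sub>C x) * norm y"
    by (rule norm_cauchy_schwarz)
  also have "\<dots> \<le> norm x * norm y"
    by (intro mult_right_mono) (simp_all add: norm_scaleC c_def norm_sgn)
  finally show ?thesis .
qed

lemma cinner_scaleR_left: "cinner (r *\<^sub>R x) y = of_real r * cinner x y"
  by (simp add: cinner_scaleC_left flip: scaleC_of_real)

lemma cinner_scaleR_right: "cinner x (r *\<^sub>R y) = of_real r * cinner x y"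
  by (simp add: cinner_scaleC_right flip: scaleC_of_real)

text \<open>Bilinearity is over the reals, hence compatible with conjugate-linearity in the second
  slot. It supplies limits and the real derivative of maps such as
  \<open>x \<mapsto> cinner (f x) x\<close>.\<close>

lemma bounded_bilinear_cinner: "bounded_bilinear cinner"
proof
  show "\<exists>K. \<forall>x y::'a. cmod (cinner x y) \<le> norm x * norm y * K"
    by (rule exI[of _ 1]) (simp add: norm_cinner_le)
qed (auto simp: cinner_add_left cinner_add_right cinner_scaleR_left cinner_scaleR_right scaleR_conv_of_real)

lemmas tendsto_cinner [tendsto_intros] = bounded_bilinear.tendsto[OF bounded_bilinear_cinner]
lemmas bounded_linear_cinner_left = bounded_bilinear.bounded_linear_left[OF bounded_bilinear_cinner]
lemmas has_derivative_cinner = bounded_bilinear.FDERIV[OF bounded_bilinear_cinner]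

lemma bounded_linear_scaleC_left: "bounded_linear (\<lambda>a. a *\<^sub>C x)"
proof (rule bounded_linear_intro)
  show "(r *\<^sub>R a) *\<^sub>C x = r *\<^sub>R (a *\<^sub>C x)" for r a
    by (simp add: scaleR_conv_of_real scaleC_scaleC flip: scaleC_of_real)
qed (auto simp: scaleC_add_left norm_scaleC)

section \<open>Affine discs in the unit ball\<close>

text \<open>Pythagoras. If the squared norms of \<open>a\<close> and \<open>b\<close> add up to 1
  and \<open>b\<close> is nonzero, \<open>a + \<zeta> *\<^sub>C b\<close> lies in the ball exactly
  when \<open>cmod \<zeta> < 1\<close>.\<close>

lemma norm_affine_disc:
  assumes "cinner a b = 0"
  shows "(norm (a + \<zeta> *\<^sub>C b))\<^sup>2 = (norm a)\<^sup>2 + (cmod \<zeta>)\<^sup>2 * (norm b)\<^sup>2"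
proof -
  have "cinner b a = 0" using assms by (metis cinner_commute complex_cnj_zero)
  then have "complex_of_real ((norm (a + \<zeta> *\<^sub>C b))\<^sup>2)
      = of_real ((norm a)\<^sup>2) + of_real ((cmod \<zeta>)\<^sup>2) * of_real ((norm b)\<^sup>2)"
    using assms unfolding cinner_self[symmetric] complex_norm_square
    by (simp add: cinner_add_left cinner_add_right cinner_scaleC_left cinner_scaleC_right)
  then show ?thesis
    unfolding of_real_mult[symmetric] of_real_add[symmetric] of_real_eq_iff .
qed

text \<open>The strict inequality shows at once that \<open>cinner x b / (1 - cinner x a)\<close>
  has a nonzero denominator and lies in the unit disc.\<close>

lemma disc_retraction:
  assumes orth: "cinner a b = 0" and unit: "(norm a)\<^sup>2 + (norm b)\<^sup>2 = 1" and x: "norm x < 1"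
  shows "cmod (cinner x b) < cmod (1 - cinner x a)"
proof (rule ccontr)
  assume le: "\<not> ?thesis"
  have not1: "cinner x y \<noteq> 1" if "norm y \<le> 1" for y
  proof
    assume "cinner x y = 1"
    then have "1 \<le> norm x * norm y"
      using norm_cinner_le[of x y] by simp
    moreover have "norm x * norm y \<le> norm x * 1"
      using that by (intro mult_left_mono) auto
    ultimately show False using x by simp
  qed
  have "norm a \<le> 1"
    using unit by (metis le_add_same_cancel1 power2_le_imp_le one_power2 zero_le_power2 zero_le_one)
  then have "cinner x b \<noteq> 0"
    using le not1[of a] by auto
  \<comment> \<open>If the claim fails, \<open>x\<close> pairs to 1 with a vector \<open>a + l b\<close> of norm at most 1.\<close>
  define l where "l = cnj ((1 - cinner x a) / cinner x b)"
  have "cmod l \<le> 1"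
    using le \<open>cinner x b \<noteq> 0\<close> unfolding l_def complex_mod_cnj by (simp add: norm_divide)
  then have "(cmod l)\<^sup>2 * (norm b)\<^sup>2 \<le> 1 * (norm b)\<^sup>2"
    by (intro mult_right_mono) (auto simp: power_le_one)
  then have "(norm (a + l *\<^sub>C b))\<^sup>2 \<le> 1\<^sup>2"
    using unit by (simp add: norm_affine_disc[OF orth])
  then have "norm (a + l *\<^sub>C b) \<le> 1"
    by (rule power2_le_imp_le) simp
  moreover have "cinner x (a + l *\<^sub>C b) = 1"
    using \<open>cinner x b \<noteq> 0\<close> by (simp add: l_def cinner_add_right cinner_scaleC_right)
  ultimately show False using not1 by blast
qed

text \<open>The derivative \<open>f'\<close> is complex linear and \<open>u\<close> is fixed in the
  antilinear slot, so by the chain rule the derivative is multiplication by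
  \<open>cinner (f' b) u\<close>.\<close>

lemma holomorphic_map_on_affine_disc:
  assumes f: "holomorphic_map_on f (ball 0 1)"
    and disc: "\<And>\<zeta>. cmod \<zeta> < 1 \<Longrightarrow> norm (a + \<zeta> *\<^sub>C b) < 1"
  shows "(\<lambda>\<zeta>. cinner (f (a + \<zeta> *\<^sub>C b)) u) holomorphic_on ball 0 1"
proof -
  have "\<exists>d. ((\<lambda>\<zeta>. cinner (f (a + \<zeta> *\<^sub>C b)) u) has_field_derivative d) (at \<zeta>)" if z: "cmod \<zeta> < 1" for \<zeta>
  proof -
    from disc[OF z] f obtain f' where
      f': "(f has_derivative f') (at (a + \<zeta> *\<^sub>C b))" and lin: "\<And>c v. f' (c *\<^sub>C v) = c *\<^sub>C f' v"
      unfolding holomorphic_map_on_def by (metis at_within_open mem_ball_0 open_ball)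
    have "((\<lambda>\<zeta>. a + \<zeta> *\<^sub>C b) has_derivative (\<lambda>x. 0 + x *\<^sub>C b)) (at \<zeta>)"
      by (intro has_derivative_add has_derivative_const
          bounded_linear.has_derivative[OF bounded_linear_scaleC_left] has_derivative_ident)
    from has_derivative_compose[OF this f']
    have "((\<lambda>\<zeta>. cinner (f (a + \<zeta> *\<^sub>C b)) u) has_derivative (\<lambda>x. cinner (f' (0 + x *\<^sub>C b)) u)) (at \<zeta>)"
      by (rule bounded_linear.has_derivative[OF bounded_linear_cinner_left])
    then have "((\<lambda>\<zeta>. cinner (f (a + \<zeta> *\<^sub>C b)) u) has_derivative (*) (cinner (f' b) u)) (at \<zeta>)"
      by (rule has_derivative_eq_rhs) (auto simp: lin cinner_scaleC_left)
    then show ?thesis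
      unfolding has_field_derivative_def by blast
  qed
  then show ?thesis
    by (auto simp: holomorphic_on_open)
qed

section \<open>Passing from the discs to the ball\<close>

lemma generator_affine_disc_eq_0:
  fixes f :: "'a::complex_hilbert_space \<Rightarrow> 'a"
  assumes f: "holomorphic_map_on f (ball 0 1)"
    and F: "continuous_semigroup F" and gen: "is_generator f F"
    and orth: "cinner a b = 0" and unit: "(norm a)\<^sup>2 + (norm b)\<^sup>2 = 1" and b: "b \<noteq> 0"
    and K: "has_K_limit (\<lambda>x. (1 / norm (x - (a + b)) ^ 3) *\<^sub>R f x) 0 (a + b)"
    and \<zeta>: "cmod \<zeta> < 1"
  shows "cinner (f (a + \<zeta> *\<^sub>C b)) b + \<zeta> * cinner (f (a + \<zeta> *\<^sub>C b)) a = 0"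
proof -
  let ?\<phi> = "\<lambda>x. a + x *\<^sub>C b"
  define N where "N = (norm b)\<^sup>2"
  have N: "0 < N" using b by (simp add: N_def)
  have orth': "cinner b a = 0" using orth by (metis cinner_commute complex_cnj_zero)
  have norm_disc: "1 - (norm (?\<phi> x))\<^sup>2 = N * (1 - (cmod x)\<^sup>2)" for x
    using unit by (simp add: norm_affine_disc[OF orth] N_def algebra_simps)
  have disc: "norm (?\<phi> x) < 1" if "cmod x < 1" for x
  proof -
    have "0 < 1 - (norm (?\<phi> x))\<^sup>2"
      unfolding norm_disc using N that by (simp add: abs_square_less_1)
    then show ?thesis by (simp add: abs_square_less_1)
  qed
  \<comment> \<open>On the disc the denominator of the retraction is the constant \<open>N\<close>,
    so together with \<open>b_disc\<close> the retraction sends \<open>?\<phi> x\<close> back to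
    \<open>x\<close>.\<close>
  have a_disc: "1 - cinner (?\<phi> x) a = of_real N" for x
  proof -
    have "N = 1 - (norm a)\<^sup>2" using unit by (simp add: N_def)
    then show ?thesis
      using orth' by (simp add: cinner_add_left cinner_scaleC_left cinner_self)
  qed
  have b_disc: "cinner (?\<phi> x) b = x * of_real N" for x
    using orth by (simp add: cinner_add_left cinner_scaleC_left cinner_self N_def)
  have F_hol: "holomorphic_map_on (F t) (ball 0 1)" and F_self: "norm x < 1 \<Longrightarrow> norm (F t x) < 1"
    if "0 < t" for t x
    using F that unfolding continuous_semigroup_def by (auto simp: image_subset_iff)
  have F_lim: "((\<lambda>t. F t x) \<longlongrightarrow> x) (at_right 0)"
    and gen_lim: "((\<lambda>t. (1 / t) *\<^sub>R (x - F t x)) \<longlongrightarrow> f x) (at_right 0)" if "norm x < 1" for x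
    using F gen that unfolding continuous_semigroup_def is_generator_def by auto
  define G where "G t x = cinner (F t (?\<phi> x)) b / (1 - cinner (F t (?\<phi> x)) a)" for t x
  define h where "h x = (cinner (f (?\<phi> x)) b + x * cinner (f (?\<phi> x)) a) / of_real N" for x
  have retr: "cmod (cinner y b) < cmod (1 - cinner y a)" if "norm y < 1" for y
    using disc_retraction[OF orth unit that] .
  have den: "1 - cinner y a \<noteq> 0" if "norm y < 1" for y
    using retr[OF that] by auto
  have "h \<zeta> = 0"
  proof (rule disc_generator_eq_0[where G = G and h = h])
    show "G t holomorphic_on ball 0 1" if "0 < t" for t
      unfolding G_def
      by (intro holomorphic_intros holomorphic_map_on_affine_disc F_hol that disc)
        (use F_self[OF that disc] den in auto)
    show "cmod (G t x) < 1" if "0 < t" "cmod x < 1" for t x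
    proof -
      have "norm (F t (?\<phi> x)) < 1" using F_self that disc by blast
      from retr[OF this] den[OF this] show ?thesis by (simp add: G_def norm_divide)
    qed
    show "((\<lambda>t. (x - G t x) / of_real t) \<longlongrightarrow> h x) (at_right 0)" if x: "cmod x < 1" for x
    proof -
      let ?X = "?\<phi> x"
      let ?q = "\<lambda>t. (1 / t) *\<^sub>R (?X - F t ?X)"
      \<comment> \<open>The functional \<open>y \<mapsto> cinner y b + x * cinner y a\<close> takes
        the value \<open>x\<close> at \<open>?X\<close>. Hence the numerator of
        \<open>x - G t x\<close> over its denominator is this functional at
        \<open>?X - F t ?X\<close>.\<close>
      let ?k = "\<lambda>t. (cinner (?q t) b + x * cinner (?q t) a) / (1 - cinner (F t ?X) a)"
      have "(?k \<longlongrightarrow> (cinner (f ?X) b + x * cinner (f ?X) a) / (1 - cinner ?X a)) (at_right 0)"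
        by (intro tendsto_intros F_lim gen_lim disc x den)
      moreover have "eventually (\<lambda>t. ?k t = (x - G t x) / of_real t) (at_right 0)"
        using eventually_at_right_less[of 0]
      proof eventually_elim
        case (elim t)
        have nz: "1 - cinner (F t ?X) a \<noteq> 0"
          using den F_self elim disc x by blast
        have "cinner (?X - F t ?X) b + x * cinner (?X - F t ?X) a
            = x * of_real N + x * (1 - of_real N) - (cinner (F t ?X) b + x * cinner (F t ?X) a)"
          unfolding cinner_diff_left b_disc a_disc[of x, symmetric] by (simp add: algebra_simps)
        also have "\<dots> = x * (1 - cinner (F t ?X) a) - cinner (F t ?X) b"
          by (simp add: algebra_simps)
        also have "cinner (F t ?X) b = G t x * (1 - cinner (F t ?X) a)"
          using nz by (simp add: G_def)
        also have "x * (1 - cinner (F t ?X) a) - G t x * (1 - cinner (F t ?X) a)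
            = (x - G t x) * (1 - cinner (F t ?X) a)"
          by (simp only: left_diff_distrib)
        finally have "cinner (?X - F t ?X) b + x * cinner (?X - F t ?X) a
            = (x - G t x) * (1 - cinner (F t ?X) a)" .
        moreover have "?k t = (1 / of_real t) * (cinner (?X - F t ?X) b + x * cinner (?X - F t ?X) a)
            / (1 - cinner (F t ?X) a)"
          unfolding cinner_scaleR_left by (simp add: algebra_simps)
        ultimately show ?case
          using nz by simp
      qed
      ultimately show ?thesis
        unfolding h_def a_disc by (simp add: tendsto_cong)
    qed
    show "h holomorphic_on ball 0 1"
      unfolding h_def
      by (intro holomorphic_intros holomorphic_map_on_affine_disc f disc) (use N in auto)
    show "((\<lambda>r. h (of_real r) / of_real ((1 - r) ^ 3)) \<longlongrightarrow> 0) (at_left 1)"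
    proof -
      define \<gamma> where "\<gamma> r = ?\<phi> (complex_of_real r)" for r
      have \<gamma>_eq: "\<gamma> r = a + r *\<^sub>R b" for r by (simp add: \<gamma>_def scaleC_of_real)
      \<comment> \<open>Here \<open>1 - cinner (\<gamma> r) (a + b)\<close> is
        \<open>(1 - r) * N\<close>, and \<open>1 - (norm (\<gamma> r))\<^sup>2\<close> is
        \<open>1 + r\<close> times that. From \<open>r = 0\<close> on, any aperture above 2 will
        do.\<close>
      have "\<gamma> r \<in> koranyi_region 3 (a + b)" if r: "0 \<le> r" "r < 1" for r
      proof -
        have "norm (\<gamma> r) < 1" using r disc unfolding \<gamma>_def by simp
        moreover have "cinner (\<gamma> r) (a + b) = 1 - of_real N + of_real r * of_real N"
          unfolding \<gamma>_def cinner_add_right b_disc a_disc[of "of_real r", symmetric] by simp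
        then have "1 - cinner (\<gamma> r) (a + b) = of_real ((1 - r) * N)"
          by (simp add: algebra_simps)
        then have "cmod (1 - cinner (\<gamma> r) (a + b)) = (1 - r) * N"
          using r N by (simp only: norm_of_real) simp
        moreover have "1 - (norm (\<gamma> r))\<^sup>2 = N * (1 - r) * (1 + r)"
          unfolding \<gamma>_def norm_disc by (simp add: power2_eq_square algebra_simps)
        moreover have "(1 - r) * N * 1 < (1 - r) * N * (3 / 2 * (1 + r))"
          using r N by (intro mult_strict_left_mono) auto
        then have "(1 - r) * N < 3 / 2 * (N * (1 - r) * (1 + r))"
          by (simp add: algebra_simps)
        ultimately show ?thesis
          by (simp add: koranyi_region_def)
      qed
      moreover have "continuous_on {0..<1} \<gamma>"
        unfolding \<gamma>_eq by (intro continuous_intros)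
      moreover have "(\<gamma> \<longlongrightarrow> a + 1 *\<^sub>R b) (at_left 1)"
        unfolding \<gamma>_eq by (intro tendsto_intros)
      ultimately have lim0: "((\<lambda>r. (1 / norm (\<gamma> r - (a + b)) ^ 3) *\<^sub>R f (\<gamma> r)) \<longlongrightarrow> 0) (at_left 1)"
        using K[unfolded has_K_limit_def, rule_format, of 3 \<gamma>] by (auto simp: image_subset_iff)
      let ?T = "\<lambda>r. (1 / norm (\<gamma> r - (a + b)) ^ 3) *\<^sub>R f (\<gamma> r)"
      \<comment> \<open>The cube of the distance contains \<open>norm b ^ 3\<close>, but
        \<open>h\<close> is divided only by \<open>N\<close>, the square of \<open>norm b\<close>;
        the extra factor \<open>norm b\<close> makes up for this.\<close>
      let ?e = "\<lambda>r. (cinner (?T r) b + of_real r * cinner (?T r) a) * of_real (norm b)"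
      have "(?e \<longlongrightarrow> (cinner 0 b + of_real 1 * cinner 0 a) * of_real (norm b)) (at_left 1)"
        by (intro tendsto_intros lim0)
      moreover have "eventually (\<lambda>r::real. r < 1) (at_left 1)"
        by (simp add: eventually_at_filter)
      then have "eventually (\<lambda>r. ?e r = h (of_real r) / of_real ((1 - r) ^ 3)) (at_left 1)"
      proof eventually_elim
        case (elim r)
        have "\<gamma> r - (a + b) = (r - 1) *\<^sub>R b" by (simp add: \<gamma>_eq algebra_simps)
        then have "norm (\<gamma> r - (a + b)) = (1 - r) * norm b" using elim by simp
        then have coeff: "norm b / norm (\<gamma> r - (a + b)) ^ 3 = 1 / (N * (1 - r) ^ 3)"
          using b by (simp add: N_def power_mult_distrib power2_eq_square power3_eq_cube)
        have "?e r = (cinner (f (\<gamma> r)) b + of_real r * cinner (f (\<gamma> r)) a)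
            * of_real (norm b / norm (\<gamma> r - (a + b)) ^ 3)"
          unfolding cinner_scaleR_left by (simp add: algebra_simps add_divide_distrib)
        also note coeff
        finally show ?case
          by (simp add: h_def \<gamma>_def)
      qed
      ultimately show ?thesis by (simp add: tendsto_cong)
    qed
  qed (rule \<zeta>)
  then show ?thesis
    using N by (simp add: h_def)
qed

text \<open>The disc through \<open>z\<close> and \<open>\<tau>\<close> gives one linear relation
  for \<open>f z\<close>, here rewritten without \<open>a\<close> and \<open>b\<close>. After
  division by \<open>(1 - cinner z z) * (1 - cinner z \<tau>)\<close>, its real part says that
  \<open>f\<close> is tangent to the horospheres at \<open>\<tau>\<close>, the level sets of
  \<open>(cmod (1 - cinner z \<tau>))\<^sup>2 / (1 - (norm z)\<^sup>2)\<close>.\<close>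

lemma generator_horosphere_identity:
  fixes f :: "'a::complex_hilbert_space \<Rightarrow> 'a"
  assumes f: "holomorphic_map_on f (ball 0 1)"
    and F: "continuous_semigroup F" and gen: "is_generator f F"
    and \<tau>: "norm \<tau> = 1"
    and K: "has_K_limit (\<lambda>x. (1 / norm (x - \<tau>) ^ 3) *\<^sub>R f x) 0 \<tau>"
    and z: "norm z < 1"
  shows "cinner (f z) \<tau> * (1 - cinner z z) = cinner (f z) z * (1 - cinner z \<tau>)"
proof -
  define v where "v = \<tau> - z"
  have "v \<noteq> 0" using \<tau> z by (auto simp: v_def)
  define N where "N = complex_of_real ((norm v)\<^sup>2)"
  have N: "N \<noteq> 0" using \<open>v \<noteq> 0\<close> by (simp add: N_def)
  define k where "k = cinner \<tau> v"
  have \<tau>\<tau>: "cinner \<tau> \<tau> = 1" using \<tau> by (simp add: cinner_self)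
  have cz: "cinner z \<tau> = cnj (cinner \<tau> z)" by (rule cinner_commute)
  have k_eq: "k = 1 - cinner \<tau> z" by (simp add: k_def v_def cinner_diff_right \<tau>\<tau>)
  have k: "k \<noteq> 0"
  proof
    assume "k = 0"
    then have "cinner \<tau> z = 1" by (simp add: k_eq)
    then show False using norm_cinner_le[of \<tau> z] \<tau> z by simp
  qed
  \<comment> \<open>\<open>b\<close> is the orthogonal projection of \<open>\<tau>\<close> to the
    complex line spanned by \<open>v\<close>, so \<open>a\<close> is the point nearest to 0 on the
    complex line through \<open>z\<close> and \<open>\<tau>\<close>.\<close>
  define b where "b = (k / N) *\<^sub>C v"
  define a where "a = \<tau> - b"
  have "cinner v v = N" by (simp add: N_def cinner_self)
  then have bv: "cinner b v = k"
    using N by (simp add: b_def cinner_scaleC_left)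
  have orth: "cinner a b = 0"
    unfolding a_def b_def cinner_scaleC_right
    by (simp add: cinner_diff_left bv[unfolded b_def] k_def[symmetric])
  have ab: "a + b = \<tau>" by (simp add: a_def)
  have "a + 1 *\<^sub>C b = \<tau>"
    using scaleC_of_real[of 1 b] by (simp add: ab)
  then have unit: "(norm a)\<^sup>2 + (norm b)\<^sup>2 = 1"
    using norm_affine_disc[OF orth, of 1] \<tau> by simp
  have b: "b \<noteq> 0"
    using bv k by auto
  \<comment> \<open>Since \<open>v = (N / k) *\<^sub>C b\<close>, the point
    \<open>z = \<tau> - v\<close> has this parameter on the disc.\<close>
  define \<zeta> where "\<zeta> = 1 - N / k"
  have "(N / k) *\<^sub>C b = v"
    using k N scaleC_of_real[of 1 v] by (simp add: b_def scaleC_scaleC)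
  moreover have "\<zeta> *\<^sub>C b + (N / k) *\<^sub>C b = b"
    using scaleC_of_real[of 1 b] by (simp add: \<zeta>_def flip: scaleC_add_left)
  ultimately have "a + \<zeta> *\<^sub>C b = a + b - v"
    by (metis add_diff_cancel_right' add_diff_eq)
  then have z_eq: "a + \<zeta> *\<^sub>C b = z"
    by (simp add: ab v_def)
  have "cmod \<zeta> < 1"
  proof -
    have "(norm a)\<^sup>2 + (cmod \<zeta>)\<^sup>2 * (norm b)\<^sup>2 < (norm a)\<^sup>2 + 1 * (norm b)\<^sup>2"
      using norm_affine_disc[OF orth, of \<zeta>] z unit abs_square_less_1[of "norm z"]
      unfolding z_eq by simp
    then have "(cmod \<zeta>)\<^sup>2 * (norm b)\<^sup>2 < 1 * (norm b)\<^sup>2"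
      by (simp only: add_less_cancel_left)
    then have "(cmod \<zeta>)\<^sup>2 < 1"
      by (rule mult_right_less_imp_less) simp
    then show ?thesis by (simp add: abs_square_less_1)
  qed
  from generator_affine_disc_eq_0[OF f F gen orth unit b _ this] K
  have eq: "cinner (f z) b + \<zeta> * cinner (f z) a = 0"
    unfolding ab z_eq by blast
  have "cinner (f z) b = cnj (k / N) * (cinner (f z) \<tau> - cinner (f z) z)"
    by (simp add: b_def v_def cinner_scaleC_right cinner_diff_right)
  moreover have "cnj N = N" by (simp add: N_def)
  ultimately have 1: "N * cinner (f z) b = cnj k * (cinner (f z) \<tau> - cinner (f z) z)"
    using N by simp
  have 2: "cinner (f z) \<tau> = cinner (f z) a + cinner (f z) b"
    by (simp add: a_def cinner_diff_right)
  have "k * (cinner (f z) b + \<zeta> * cinner (f z) a) = k * cinner (f z) \<tau> - N * cinner (f z) a"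
    unfolding 2 using k by (simp add: \<zeta>_def algebra_simps)
  then have 3: "k * cinner (f z) \<tau> = N * cinner (f z) a"
    unfolding eq by simp
  have "cnj k * (cinner (f z) \<tau> - cinner (f z) z) + (k - N) * cinner (f z) \<tau>
      = N * cinner (f z) b + N * cinner (f z) a - N * cinner (f z) \<tau>"
    by (simp only: 1 left_diff_distrib flip: 3) simp
  also have "\<dots> = 0"
    unfolding 2 by (simp add: algebra_simps)
  finally have "cnj k * (cinner (f z) \<tau> - cinner (f z) z) + (k - N) * cinner (f z) \<tau> = 0" .
  \<comment> \<open>Expanding \<open>cinner v v\<close> shows that the coefficient
    \<open>cnj k + k - N\<close> of \<open>cinner (f z) \<tau>\<close> is
    \<open>1 - cinner z z\<close>.\<close>
  moreover have "N = k + cnj k - 1 + cinner z z"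
    unfolding k_eq N_def cinner_self[symmetric]
    by (simp add: v_def cinner_diff_left cinner_diff_right \<tau>\<tau> cz algebra_simps)
  moreover have "cnj k = 1 - cinner z \<tau>"
    by (simp add: k_eq cz)
  ultimately show ?thesis
    by (simp add: algebra_simps)
qed

theorem mainTheorem1:
  fixes f :: "'a::complex_hilbert_space \<Rightarrow> 'a"
    and \<tau> :: 'a
  assumes "holomorphic_map_on f (ball 0 1)"
    and "\<exists>F. continuous_semigroup F \<and> is_generator f F"
    and "norm \<tau> = 1"
    and "has_K_limit (\<lambda>x. (1 / norm (x - \<tau>) ^ 3) *\<^sub>R f x) 0 \<tau>"
  shows "\<forall>z\<in>ball 0 1. f z = 0"
proof
  fix z :: 'a assume z: "z \<in> ball 0 1"
  let ?g = "\<lambda>x. cinner (f x) \<tau> * (1 - cinner x x) - cinner (f x) x * (1 - cinner x \<tau>)"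
  from assms have g0: "?g x = 0" if "x \<in> ball 0 1" for x
    using generator_horosphere_identity that by (auto simp: mem_ball_0)
  from z assms(1) obtain f' where
    f': "(f has_derivative f') (at z)" and lin: "\<And>c v. f' (c *\<^sub>C v) = c *\<^sub>C f' v"
    unfolding holomorphic_map_on_def by (metis at_within_open open_ball)
  note der = has_derivative_cinner has_derivative_mult has_derivative_diff has_derivative_const
    has_derivative_ident f'
  let ?D = "\<lambda>v. (cinner (f z) \<tau> * (0 - (cinner z v + cinner v z))
      + (cinner (f z) 0 + cinner (f' v) \<tau>) * (1 - cinner z z))
    - (cinner (f z) z * (0 - (cinner z 0 + cinner v \<tau>)) + (cinner (f z) v + cinner (f' v) z) * (1 - cinner z \<tau>))"
  have "(?g has_derivative ?D) (at z)"
    by (intro der)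
  moreover have "(?g has_derivative (\<lambda>v. 0)) (at z)"
    by (rule has_derivative_transform_within_open[OF has_derivative_const open_ball z])
      (simp only: g0)
  ultimately have "?D = (\<lambda>v. 0)"
    by (rule has_derivative_unique)
  then have D0: "?D v = 0" for v
    by (rule fun_cong)
  \<comment> \<open>The derivative at \<open>v\<close> is \<open>?L - ?A\<close> with
    \<open>?L\<close> complex linear and \<open>?A\<close> antilinear in \<open>v\<close>. Replacing
    \<open>v\<close> by \<open>\<i> *\<^sub>C v\<close> turns it into
    \<open>\<i> * (?L + ?A)\<close>, so both parts vanish.\<close>
  have anti: "cinner (f z) \<tau> * cinner z v + cinner (f z) v * (1 - cinner z \<tau>) = 0" for v
  proof -
    let ?L = "cinner (f' v) \<tau> * (1 - cinner z z) - cinner (f z) \<tau> * cinner v z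
      + cinner (f z) z * cinner v \<tau> - cinner (f' v) z * (1 - cinner z \<tau>)"
    let ?A = "cinner (f z) \<tau> * cinner z v + cinner (f z) v * (1 - cinner z \<tau>)"
    have "?L - ?A = 0"
      using D0[of v] unfolding cinner_zero_right by algebra
    moreover have "\<i> * (?L + ?A) = 0"
      using D0[of "\<i> *\<^sub>C v"]
      unfolding cinner_zero_right lin cinner_scaleC_left cinner_scaleC_right complex_cnj_i by algebra
    then have "?L + ?A = 0" by simp
    ultimately show ?thesis by algebra
  qed
  \<comment> \<open>For \<open>v = z\<close>, the horosphere identity replaces the second summand by
    \<open>cinner (f z) \<tau> * (1 - cinner z z)\<close>, and the sum collapses to
    \<open>cinner (f z) \<tau>\<close>.\<close>
  have "cinner (f z) \<tau> = 0"
    using anti[of z] g0[OF z] by (simp add: algebra_simps)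
  moreover have "1 - cinner z \<tau> \<noteq> 0"
    using norm_cinner_le[of z \<tau>] z assms(3) by auto
  ultimately have "cinner (f z) (f z) = 0"
    using anti[of "f z"] by simp
  then show "f z = 0"
    by (simp add: cinner_self)
qed

end
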